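(* Let $n\ge2$, let $w(n)>0$ be a constant and let $\underline S=(S_1,\dots,S_n)$ be a tuple of bounded operators on a Hilbert space. The following are equivalent. (1) $\underline S\in AY_n$ and the numerical radius of each fundamental operator $X_i$, $i=1,\dots,n-1$, is not greater than $w(n)$. (2) $w(n)(I-S_n^*S_n)\ge \mathrm{Re}\big(e^{\sqrt{-1}\,\theta}(S_i-S_{n-i}^*S_n)\big)$ for all $\theta\in[0,2\pi)$ and all $i=1,\dots,n-1$.
   Context: For a contraction $T$, $D_T=(I-T^*T)^{1/2}$ and $\mathcal D_T=\overline{\mathrm{Ran}}\,D_T$. A tuple $\underline S=(S_1,\dots,S_n)$ (not assumed commuting) is in the Agler-Young class $AY_n$ if $S_n$ is a contraction and there are operators $X_i\in\mathcal B(\mathcal D_{S_n})$ (necessarily unique, called the fundamental operators) with $S_i-S_{n-i}^*S_n=D_{S_n}X_iD_{S_n}$ for $i=1,\dots,n-1$. $\mathrm{Re}\,A=(A+A^* )/2$. *)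

theory Defs
  imports "HOL-Analysis.Analysis"
begin

text \<open>
  Complex Hilbert spaces. Norm, metric, topology and completeness come from the class
  \<^class>\<open>banach\<close>; the inner product is linear in its first argument. Positive definiteness is
  contained in \<open>cinner_self\<close>.
\<close>

class chilbert_space = banach +
  fixes scaleC :: "complex \<Rightarrow> 'a \<Rightarrow> 'a" (infixr "*\<^sub>C" 75)
    and cinner :: "'a \<Rightarrow> 'a \<Rightarrow> complex"
  assumes scaleR_scaleC: "r *\<^sub>R x = complex_of_real r *\<^sub>C x"
    and scaleC_add_right: "a *\<^sub>C (x + y) = a *\<^sub>C x + a *\<^sub>C y"
    and scaleC_add_left: "(a + b) *\<^sub>C x = a *\<^sub>C x + b *\<^sub>C x"
    and scaleC_scaleC: "a *\<^sub>C (b *\<^sub>C x) = (a * b) *\<^sub>C x"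
    and cinner_commute: "cinner x y = cnj (cinner y x)"
    and cinner_add_left: "cinner (x + y) z = cinner x z + cinner y z"
    and cinner_scaleC_left: "cinner (a *\<^sub>C x) y = a * cinner x y"
    and cinner_self: "cinner x x = complex_of_real ((norm x)\<^sup>2)"

instantiation complex :: chilbert_space
begin

definition scaleC_complex :: "complex \<Rightarrow> complex \<Rightarrow> complex"
  where "scaleC_complex a x = a * x"

definition cinner_complex :: "complex \<Rightarrow> complex \<Rightarrow> complex"
  where "cinner_complex x y = x * cnj y"

instance
  by standard
    (simp_all add: scaleC_complex_def cinner_complex_def scaleR_conv_of_real algebra_simps
      flip: complex_norm_square)

end

text \<open>Bounded operators on the whole space, i.e. elements of \<open>B(H)\<close>, are represented by functions.\<close>

definition bounded_clinear :: "('a::chilbert_space \<Rightarrow> 'a) \<Rightarrow> bool"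
  where "bounded_clinear T \<longleftrightarrow> bounded_linear T \<and> (\<forall>c x. T (c *\<^sub>C x) = c *\<^sub>C T x)"

definition contraction :: "('a::chilbert_space \<Rightarrow> 'a) \<Rightarrow> bool"
  where "contraction T \<longleftrightarrow> bounded_clinear T \<and> (\<forall>x. norm (T x) \<le> norm x)"

text \<open>Well defined for bounded operators by the Riesz representation theorem.\<close>

definition cadjoint :: "('a::chilbert_space \<Rightarrow> 'a) \<Rightarrow> 'a \<Rightarrow> 'a"
  where "cadjoint T = (THE T'. \<forall>x y. cinner (T x) y = cinner x (T' y))"

definition op_Re :: "('a::chilbert_space \<Rightarrow> 'a) \<Rightarrow> 'a \<Rightarrow> 'a"
  where "op_Re A = (\<lambda>x. (1/2) *\<^sub>R (A x + cadjoint A x))"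

definition positive_op :: "('a::chilbert_space \<Rightarrow> 'a) \<Rightarrow> bool"
  where "positive_op A \<longleftrightarrow>
    bounded_clinear A \<and> (\<forall>x. cinner (A x) x \<in> \<real> \<and> 0 \<le> Re (cinner (A x) x))"

definition op_le :: "('a::chilbert_space \<Rightarrow> 'a) \<Rightarrow> ('a \<Rightarrow> 'a) \<Rightarrow> bool"
  where "op_le A B \<longleftrightarrow> positive_op (\<lambda>x. B x - A x)"

text \<open>The positive square root; it exists and is unique whenever \<open>A\<close> is positive.\<close>

definition op_sqrt :: "('a::chilbert_space \<Rightarrow> 'a) \<Rightarrow> 'a \<Rightarrow> 'a"
  where "op_sqrt A = (THE B. positive_op B \<and> B \<circ> B = A)"

definition defect_op :: "('a::chilbert_space \<Rightarrow> 'a) \<Rightarrow> 'a \<Rightarrow> 'a"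
  where "defect_op T = op_sqrt (\<lambda>x. x - cadjoint T (T x))"

definition defect_space :: "('a::chilbert_space \<Rightarrow> 'a) \<Rightarrow> 'a set"
  where "defect_space T = closure (range (defect_op T))"

text \<open>
  An operator on a closed subspace \<open>M\<close> is represented by a function on the whole type of which only
  the values on \<open>M\<close> matter.
\<close>

definition bounded_clinear_on :: "'a::chilbert_space set \<Rightarrow> ('a \<Rightarrow> 'a) \<Rightarrow> bool"
  where "bounded_clinear_on M X \<longleftrightarrow>
    (\<forall>x\<in>M. X x \<in> M) \<and>
    (\<forall>x\<in>M. \<forall>y\<in>M. X (x + y) = X x + X y) \<and>
    (\<forall>c. \<forall>x\<in>M. X (c *\<^sub>C x) = c *\<^sub>C X x) \<and>
    (\<exists>K. \<forall>x\<in>M. norm (X x) \<le> K * norm x)"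

text \<open>
  The adjoined \<open>0\<close> only matters for \<open>M = {0}\<close>, where there are no unit vectors and the
  numerical radius is \<open>0\<close> by convention.
\<close>

definition numerical_radius_on :: "'a::chilbert_space set \<Rightarrow> ('a \<Rightarrow> 'a) \<Rightarrow> real"
  where "numerical_radius_on M X =
    Sup (insert 0 {cmod (cinner (X x) x) | x. x \<in> M \<and> norm x = 1})"

text \<open>
  A tuple \<open>(S\<^sub>1, \<dots>, S\<^sub>n)\<close> is a function on \<^typ>\<open>nat\<close> of which only the values at \<open>1, \<dots>, n\<close> matter.
  The operator \<open>X\<close> below is unique only as an operator on the defect space of \<open>S n\<close>, hence the
  relational form.
\<close>

definition is_fundamental_op ::
    "nat \<Rightarrow> (nat \<Rightarrow> 'a::chilbert_space \<Rightarrow> 'a) \<Rightarrow> nat \<Rightarrow> ('a \<Rightarrow> 'a) \<Rightarrow> bool"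
  where "is_fundamental_op n S i X \<longleftrightarrow>
    bounded_clinear_on (defect_space (S n)) X \<and>
    (\<forall>x. S i x - cadjoint (S (n - i)) (S n x) = defect_op (S n) (X (defect_op (S n) x)))"

definition AY :: "nat \<Rightarrow> (nat \<Rightarrow> 'a::chilbert_space \<Rightarrow> 'a) \<Rightarrow> bool"
  where "AY n S \<longleftrightarrow>
    (\<forall>i\<in>{1..n}. bounded_clinear (S i)) \<and>
    contraction (S n) \<and>
    (\<forall>i\<in>{1..n-1}. \<exists>X. is_fundamental_op n S i X)"

end

theory Submission
  imports Defs
begin

text \<open>
  Letting \<open>\<theta>\<close> vary, the second condition says \<open>\<bar>\<langle>A x, x\<rangle>\<bar> \<le> w \<langle>(I - S\<^sub>n\<^sup>* S\<^sub>n) x, x\<rangle>\<close> for each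
  \<open>A = S\<^sub>i - S\<^sub>n\<^sub>-\<^sub>i\<^sup>* S\<^sub>n\<close>. In particular \<open>S\<^sub>n\<close> is a contraction, and the right-hand side is
  \<open>w \<parallel>D x\<parallel>\<^sup>2\<close> for its defect operator \<open>D\<close>. By polarization
  \<open>\<bar>\<langle>A x, y\<rangle>\<bar> \<le> 2 w \<parallel>D x\<parallel> \<parallel>D y\<parallel>\<close>, so the form factors as \<open>\<langle>X D x, D y\<rangle>\<close> with \<open>X\<close> bounded on the
  defect space. Conversely \<open>\<langle>A x, x\<rangle> = \<langle>X D x, D x\<rangle>\<close>, and the range of \<open>D\<close> is dense in the
  defect space, so the same inequality expresses that the numerical radius of \<open>X\<close> is at most \<open>w\<close>.
\<close>

section \<open>Inner products\<close>

lemma scaleC_minus_one [simp]: "(-1) *\<^sub>C x = - (x::'a::chilbert_space)"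
  using scaleR_scaleC[of "-1" x] by simp

lemma scaleC_minus_right: "c *\<^sub>C (- x) = - (c *\<^sub>C (x::'a::chilbert_space))"
  by (metis mult.commute scaleC_minus_one scaleC_scaleC)

lemma scaleC_diff_right: "c *\<^sub>C (x - y) = c *\<^sub>C x - c *\<^sub>C (y::'a::chilbert_space)"
  by (metis add_uminus_conv_diff scaleC_add_right scaleC_minus_right)

lemma scaleC_scaleR_commute: "c *\<^sub>C (r *\<^sub>R x) = r *\<^sub>R (c *\<^sub>C (x::'a::chilbert_space))"
  by (simp add: scaleR_scaleC scaleC_scaleC mult.commute)

lemma cinner_add_right: "cinner x (y + z) = cinner x y + cinner x (z::'a::chilbert_space)"
  by (metis cinner_add_left cinner_commute complex_cnj_add)

lemma cinner_scaleC_right: "cinner x (c *\<^sub>C y) = cnj c * cinner x (y::'a::chilbert_space)"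
  by (metis cinner_commute cinner_scaleC_left complex_cnj_mult)

lemma cinner_scaleR_left: "cinner (r *\<^sub>R x) y = of_real r * cinner x (y::'a::chilbert_space)"
  by (simp add: scaleR_scaleC cinner_scaleC_left)

lemma cinner_scaleR_right: "cinner x (r *\<^sub>R y) = of_real r * cinner x (y::'a::chilbert_space)"
  by (simp add: scaleR_scaleC cinner_scaleC_right)

lemma cinner_minus_left: "cinner (- x) y = - cinner x (y::'a::chilbert_space)"
  using cinner_scaleR_left[of "-1" x y] by simp

lemma cinner_minus_right: "cinner x (- y) = - cinner x (y::'a::chilbert_space)"
  using cinner_scaleR_right[of x "-1" y] by simp

lemma cinner_diff_left: "cinner (x - y) z = cinner x z - cinner y (z::'a::chilbert_space)"
  using cinner_add_left[of x "-y" z] by (simp add: cinner_minus_left)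

lemma cinner_diff_right: "cinner x (y - z) = cinner x y - cinner x (z::'a::chilbert_space)"
  using cinner_add_right[of x y "-z"] by (simp add: cinner_minus_right)

lemma cinner_zero_left [simp]: "cinner 0 (x::'a::chilbert_space) = 0"
  using cinner_diff_left[of 0 0 x] by simp

lemma cinner_zero_right [simp]: "cinner (x::'a::chilbert_space) 0 = 0"
  using cinner_diff_right[of x 0 0] by simp

lemma Re_cinner_self: "Re (cinner x x) = (norm (x::'a::chilbert_space))\<^sup>2"
  by (simp add: cinner_self)

lemma Re_cinner_commute: "Re (cinner x y) = Re (cinner y (x::'a::chilbert_space))"
  by (subst cinner_commute) simp

lemma cinner_right_eqI:
  fixes a b :: "'a::chilbert_space"
  assumes "\<And>y. cinner y a = cinner y b"
  shows "a = b"
proof -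
  have "cinner (a - b) (a - b) = 0"
    using assms by (simp add: cinner_diff_right)
  then show ?thesis
    by (simp add: cinner_self)
qed

lemma norm_add_square:
  fixes x y :: "'a::chilbert_space"
  shows "(norm (x + y))\<^sup>2 = (norm x)\<^sup>2 + (norm y)\<^sup>2 + 2 * Re (cinner x y)"
  using Re_cinner_commute[of y x]
  by (simp add: cinner_add_left cinner_add_right flip: Re_cinner_self)

lemma norm_scaleC: "norm (c *\<^sub>C x) = cmod c * norm (x::'a::chilbert_space)"
proof -
  have "(norm (c *\<^sub>C x))\<^sup>2 = Re (c * cnj c * cinner x x)"
    by (simp only: Re_cinner_self[symmetric] cinner_scaleC_left cinner_scaleC_right mult_ac)
  also have "\<dots> = (cmod c * norm x)\<^sup>2"
    unfolding cinner_self complex_norm_square[symmetric] of_real_mult[symmetric] Re_complex_of_real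
    by (simp add: power_mult_distrib)
  finally show ?thesis
    by (simp add: power2_eq_iff_nonneg)
qed

text \<open>The angle is the argument of \<open>cnj z\<close>; \<open>Arg2pi\<close> puts it in the
  half-open interval that occurs in the theorem. Such a rotation turns bounds on real parts into
  bounds on moduli.\<close>

lemma obtain_rotation:
  obtains \<theta> where "\<theta> \<in> {0..<2*pi}" "exp (\<i> * complex_of_real \<theta>) * z = of_real (cmod z)"
proof
  have eq: "cnj z = of_real (cmod z) * exp (\<i> * of_real (Arg2pi (cnj z)))"
    using Arg2pi_eq[of "cnj z"] by simp
  have "z = of_real (cmod z) * exp (- (\<i> * of_real (Arg2pi (cnj z))))"
    using arg_cong[OF eq, of cnj] by (simp add: exp_cnj)
  then show "exp (\<i> * complex_of_real (Arg2pi (cnj z))) * z = of_real (cmod z)"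
    by (metis exp_minus_inverse mult.left_commute mult.right_neutral)
  show "Arg2pi (cnj z) \<in> {0..<2*pi}"
    using Arg2pi_ge_0 Arg2pi_lt_2pi by auto
qed

text \<open>The triangle inequality comes with the norm; squaring it bounds the real part of the
  inner product. Rotating the first argument then replaces the real part by the modulus.\<close>

lemma Cauchy_Schwarz: "cmod (cinner x y) \<le> norm x * norm (y::'a::chilbert_space)"
proof -
  have *: "Re (cinner u y) \<le> norm u * norm y" for u
  proof -
    have "(norm (u + y))\<^sup>2 \<le> (norm u + norm y)\<^sup>2"
      by (simp add: norm_triangle_ineq)
    then show ?thesis
      by (simp add: norm_add_square power2_sum)
  qed
  obtain \<theta> where "exp (\<i> * complex_of_real \<theta>) * cinner x y = of_real (cmod (cinner x y))"
    using obtain_rotation by blast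
  then show ?thesis
    using *[of "exp (\<i> * complex_of_real \<theta>) *\<^sub>C x"]
    by (simp add: cinner_scaleC_left norm_scaleC)
qed

lemma bounded_bilinear_cinner: "bounded_bilinear (cinner :: 'a::chilbert_space \<Rightarrow> _)"
proof
  show "\<exists>K. \<forall>a b::'a. cmod (cinner a b) \<le> norm a * norm b * K"
    using Cauchy_Schwarz by (intro exI[of _ 1] allI) simp
qed (simp_all add: cinner_add_left cinner_add_right cinner_scaleR_left cinner_scaleR_right
      scaleR_conv_of_real)

lemmas tendsto_cinner [tendsto_intros] = bounded_bilinear.tendsto[OF bounded_bilinear_cinner]

lemma bounded_linear_scaleC: "bounded_linear (\<lambda>x::'a::chilbert_space. c *\<^sub>C x)"
  by (intro bounded_linear_intro[where K = "cmod c"])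
    (simp_all add: scaleC_add_right scaleC_scaleR_commute norm_scaleC mult.commute)

section \<open>Bounded operators\<close>

lemma bounded_clinearI:
  fixes T :: "'a::chilbert_space \<Rightarrow> 'a"
  assumes "\<And>x y. T (x + y) = T x + T y" "\<And>c x. T (c *\<^sub>C x) = c *\<^sub>C T x"
    and "\<And>x. norm (T x) \<le> K * norm x"
  shows "bounded_clinear T"
  unfolding bounded_clinear_def
  by (intro conjI bounded_linear_intro[where K = K])
    (use assms in \<open>simp_all add: scaleR_scaleC mult.commute\<close>)

lemma bounded_clinear_bounded_linear: "bounded_clinear T \<Longrightarrow> bounded_linear T"
  by (simp add: bounded_clinear_def)

lemma bounded_clinear_add: "bounded_clinear T \<Longrightarrow> T (x + y) = T x + T y"
  by (simp add: bounded_clinear_def linear_simps)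

lemma bounded_clinear_diff: "bounded_clinear T \<Longrightarrow> T (x - y) = T x - T y"
  by (simp add: bounded_clinear_def linear_simps)

lemma bounded_clinear_zero: "bounded_clinear T \<Longrightarrow> T 0 = 0"
  by (simp add: bounded_clinear_def linear_simps)

lemma bounded_clinear_scaleC: "bounded_clinear T \<Longrightarrow> T (c *\<^sub>C x) = c *\<^sub>C T x"
  by (simp add: bounded_clinear_def)

lemma bounded_clinear_scaleR: "bounded_clinear T \<Longrightarrow> T (r *\<^sub>R x) = r *\<^sub>R T x"
  by (simp add: bounded_clinear_def linear_simps)

lemma bounded_clinear_bound:
  assumes "bounded_clinear T"
  obtains K where "K \<ge> 0" "\<And>x. norm (T x) \<le> K * norm x"
  using bounded_linear.nonneg_bounded[OF bounded_clinear_bounded_linear[OF assms]]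
  by (metis mult.commute)

lemma tendsto_bounded_clinear:
  "bounded_clinear T \<Longrightarrow> (f \<longlongrightarrow> l) F \<Longrightarrow> ((\<lambda>x. T (f x)) \<longlongrightarrow> T l) F"
  by (rule bounded_linear.tendsto[OF bounded_clinear_bounded_linear])

lemma bounded_clinear_ident: "bounded_clinear (\<lambda>x. x)"
  by (simp add: bounded_clinear_def bounded_linear_ident)

lemma bounded_clinear_null: "bounded_clinear (\<lambda>x. 0)"
  by (rule bounded_clinearI[where K = 0]) (simp_all add: bounded_linear_scaleC linear_simps)

lemma bounded_clinear_compose:
  "bounded_clinear T \<Longrightarrow> bounded_clinear U \<Longrightarrow> bounded_clinear (\<lambda>x. T (U x))"
  by (simp add: bounded_clinear_def bounded_linear_compose)

lemma bounded_clinear_plus: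
  "bounded_clinear T \<Longrightarrow> bounded_clinear U \<Longrightarrow> bounded_clinear (\<lambda>x. T x + U x)"
  by (simp add: bounded_clinear_def bounded_linear_add scaleC_add_right)

lemma bounded_clinear_minus:
  "bounded_clinear T \<Longrightarrow> bounded_clinear U \<Longrightarrow> bounded_clinear (\<lambda>x. T x - U x)"
  by (simp add: bounded_clinear_def bounded_linear_sub scaleC_diff_right)

lemma bounded_clinear_scaledR:
  "bounded_clinear T \<Longrightarrow> bounded_clinear (\<lambda>x. r *\<^sub>R T x)"
  by (simp add: bounded_clinear_def bounded_linear_const_scaleR scaleC_scaleR_commute)

lemma bounded_clinear_scaledC:
  "bounded_clinear T \<Longrightarrow> bounded_clinear (\<lambda>x. c *\<^sub>C T x)"
  by (simp add: bounded_clinear_def scaleC_scaleC mult.commute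
      bounded_linear_compose[OF bounded_linear_scaleC])

section \<open>Riesz representation relative to an operator\<close>

lemma closure_range_add:
  assumes D: "bounded_clinear D" and "u \<in> closure (range D)" "v \<in> closure (range D)"
  shows "u + v \<in> closure (range D)"
proof -
  obtain x y where xy: "\<And>k. x k \<in> range D" "x \<longlonglongrightarrow> u" "\<And>k. y k \<in> range D" "y \<longlonglongrightarrow> v"
    using assms(2,3) by (auto simp: closure_sequential)
  have "x k + y k \<in> range D" for k
    using xy(1)[of k] xy(3)[of k] by (auto simp flip: bounded_clinear_add[OF D])
  then show ?thesis
    using tendsto_add[OF xy(2,4)] unfolding closure_sequential
    by (intro exI[of _ "\<lambda>k. x k + y k"]) simp
qed

lemma closure_range_scaleC:
  assumes "bounded_clinear D" "u \<in> closure (range D)"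
  shows "c *\<^sub>C u \<in> closure (range D)"
proof -
  have "(\<lambda>x. c *\<^sub>C x) ` closure (range D) \<subseteq> closure ((\<lambda>x. c *\<^sub>C x) ` range D)"
    by (rule closure_bounded_linear_image_subset[OF bounded_linear_scaleC])
  also have "\<dots> \<subseteq> closure (range D)"
    by (intro closure_mono) (auto simp flip: bounded_clinear_scaleC[OF assms(1)])
  finally show ?thesis
    using assms by auto
qed

lemma closure_range_diff:
  assumes "bounded_clinear D" "u \<in> closure (range D)" "v \<in> closure (range D)"
  shows "u - v \<in> closure (range D)"
  using closure_range_add[OF assms(1,2) closure_range_scaleC[OF assms(1,3), of "-1"]] by simp

text \<open>The difference \<open>u - v\<close> is orthogonal to the range of \<open>D\<close> and
  lies in its closure, so by continuity it is orthogonal to itself. This makes representing vectors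
  in the closure unique.\<close>

lemma closure_range_eqI:
  assumes D: "bounded_clinear D" and "u \<in> closure (range D)" "v \<in> closure (range D)"
    and eq: "\<And>y. cinner (D y) u = cinner (D y) v"
  shows "u = v"
proof -
  obtain y where y: "\<And>k. y k \<in> range D" "y \<longlonglongrightarrow> u - v"
    using closure_range_diff[OF assms(1-3)] by (auto simp: closure_sequential)
  have "cinner (y k) (u - v) = 0" for k
    using y(1)[of k] eq by (auto simp: cinner_diff_right)
  moreover have "(\<lambda>k. cinner (y k) (u - v)) \<longlonglongrightarrow> cinner (u - v) (u - v)"
    by (intro tendsto_intros y)
  ultimately have "cinner (u - v) (u - v) = 0"
    by (simp add: LIMSEQ_const_iff)
  then show ?thesis
    by (simp add: cinner_self)
qed

text \<open>The quadratic attains its minimum, zero, at \<open>t = 0\<close>, so its derivative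
  \<open>a\<close> vanishes there. This serves as the first-variation argument for
  minimizers.\<close>

lemma linear_coeff_zero:
  fixes a b :: real
  assumes "\<And>t. 0 \<le> t * a + t\<^sup>2 * b"
  shows "a = 0"
proof (rule ccontr)
  assume "a \<noteq> 0"
  \<comment> \<open>For this \<open>t\<close> the upper bound with \<open>\<bar>b\<bar>\<close> in
    place of \<open>b\<close> becomes a negative square; the added 1 keeps the denominator
    positive.\<close>
  define t where "t = - a / (\<bar>b\<bar> + 1)"
  have "t * a + t\<^sup>2 * b \<le> t * a + t\<^sup>2 * \<bar>b\<bar>"
    by (simp add: mult_left_mono)
  also have "\<dots> = - (a / (\<bar>b\<bar> + 1))\<^sup>2"
    by (simp add: t_def power2_eq_square divide_simps) (simp add: algebra_simps)
  also have "\<dots> < 0"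
    using \<open>a \<noteq> 0\<close> by simp
  finally show False
    using assms[of t] by simp
qed

text \<open>For \<open>D = id\<close> this is the Riesz representation theorem; a general \<open>D\<close> gives Douglas-type
  factorizations. The vector \<open>z\<close> is the limit of \<open>D y\<close> along a minimizing sequence of
  \<open>\<parallel>D y\<parallel>\<^sup>2 - 2 Re (f y)\<close>.\<close>

lemma Riesz_relative:
  fixes D :: "'a::chilbert_space \<Rightarrow> 'a" and f :: "'a \<Rightarrow> complex"
  assumes D: "bounded_clinear D"
    and f_add: "\<And>x y. f (x + y) = f x + f y" and f_scale: "\<And>c x. f (c *\<^sub>C x) = c * f x"
    and f_bound: "\<And>x. cmod (f x) \<le> C * norm (D x)" and "C \<ge> 0"
  shows "\<exists>z. z \<in> closure (range D) \<and> (\<forall>y. f y = cinner (D y) z) \<and> norm z \<le> C"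
proof -
  define J where "J y = (norm (D y))\<^sup>2 - 2 * Re (f y)" for y
  have f_scaleR: "f (r *\<^sub>R x) = of_real r * f x" for r x
    by (simp add: scaleR_scaleC f_scale)
  \<comment> \<open>Completing the square: \<open>J y\<close> is at least
    \<open>(norm (D y) - C)\<^sup>2 - C\<^sup>2\<close>.\<close>
  have "J y \<ge> - C\<^sup>2" for y
  proof -
    have "Re (f y) \<le> C * norm (D y)"
      using complex_Re_le_cmod[of "f y"] f_bound[of y] by linarith
    moreover have "(norm (D y) - C)\<^sup>2 \<ge> 0"
      by simp
    ultimately show ?thesis
      by (simp add: J_def power2_diff algebra_simps)
  qed
  then have bdd: "bdd_below (range J)"
    by (auto intro: bdd_belowI[of _ "- C\<^sup>2"])
  define m where "m = Inf (range J)"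
  have m_le: "m \<le> J y" for y
    unfolding m_def by (rule cInf_lower[OF _ bdd]) simp
  have "\<exists>y. J y < m + 1 / real (Suc k)" for k
  proof -
    have "Inf (range J) < m + 1 / real (Suc k)"
      by (simp add: m_def)
    then show ?thesis
      using cInf_less_iff[OF _ bdd] by auto
  qed
  then obtain y where y: "\<And>k. J (y k) < m + 1 / real (Suc k)"
    by metis
  have Jy: "(\<lambda>k. J (y k)) \<longlonglongrightarrow> m"
  proof (rule tendsto_sandwich[OF _ _ tendsto_const])
    show "(\<lambda>k. m + 1 / real (Suc k)) \<longlonglongrightarrow> m"
      using tendsto_add[OF tendsto_const[of m] LIMSEQ_inverse_real_of_nat]
      by (simp add: inverse_eq_divide)
  qed (use m_le y in \<open>auto intro!: eventuallyI less_imp_le\<close>)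
  \<comment> \<open>The parallelogram law, combined with the fact that \<open>J\<close> is at least
    \<open>m\<close> at the midpoint of \<open>u\<close> and \<open>v\<close>. It forces
    \<open>D y\<close> to be Cauchy along a minimizing sequence.\<close>
  have par: "(norm (D u - D v))\<^sup>2 \<le> 2 * (J u - m) + 2 * (J v - m)" for u v
  proof -
    have "D ((1/2) *\<^sub>R (u + v)) = (1/2) *\<^sub>R (D u + D v)"
      using D by (simp add: bounded_clinear_add bounded_clinear_scaleR)
    then have "J ((1/2) *\<^sub>R (u + v)) = (norm (D u + D v))\<^sup>2 / 4 - Re (f u) - Re (f v)"
      by (simp add: J_def f_scaleR f_add power_divide add_divide_distrib)
    moreover have "(norm (D u - D v))\<^sup>2 + (norm (D u + D v))\<^sup>2
        = 2 * (norm (D u))\<^sup>2 + 2 * (norm (D v))\<^sup>2"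
      using norm_add_square[of "D u" "D v"] norm_add_square[of "D u" "- D v"]
      by (simp add: cinner_minus_right)
    ultimately show ?thesis
      using m_le[of "(1/2) *\<^sub>R (u + v)"] by (simp add: J_def)
  qed
  have "Cauchy (\<lambda>k. D (y k))"
  proof (rule metric_CauchyI)
    fix e :: real assume "e > 0"
    \<comment> \<open>With \<open>e\<^sup>2 / 4\<close>, the two terms on the right of
      \<open>par\<close> contribute less than \<open>e\<^sup>2 / 2\<close> each.\<close>
    then have "\<forall>\<^sub>F k in sequentially. J (y k) < m + e\<^sup>2 / 4"
      using order_tendstoD(2)[OF Jy] by simp
    then obtain N where N: "\<And>k. k \<ge> N \<Longrightarrow> J (y k) < m + e\<^sup>2 / 4"
      by (auto simp: eventually_sequentially)
    have "dist (D (y i)) (D (y j)) < e" if "i \<ge> N" "j \<ge> N" for i j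
    proof -
      have "(norm (D (y i) - D (y j)))\<^sup>2 < e\<^sup>2"
        using par[of "y i" "y j"] N[OF that(1)] N[OF that(2)] by simp
      then show ?thesis
        using \<open>e > 0\<close> by (simp add: dist_norm power2_less_imp_less)
    qed
    then show "\<exists>N. \<forall>i\<ge>N. \<forall>j\<ge>N. dist (D (y i)) (D (y j)) < e"
      by blast
  qed
  then obtain z where z: "(\<lambda>k. D (y k)) \<longlonglongrightarrow> z"
    by (auto simp: Cauchy_convergent_iff convergent_def)
  have Re_f: "Re (f v) = Re (cinner (D v) z)" for v
  proof -
    \<comment> \<open>First variation: \<open>J (y k + t v)\<close> is at least \<open>m\<close>,
      and in the limit its constant term is \<open>m\<close> itself.\<close>
    have "0 \<le> t * (2 * Re (cinner z (D v)) - 2 * Re (f v)) + t\<^sup>2 * (norm (D v))\<^sup>2" for t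
    proof -
      have "J (y k + t *\<^sub>R v) = J (y k) + t * (2 * Re (cinner (D (y k)) (D v)) - 2 * Re (f v))
          + t\<^sup>2 * (norm (D v))\<^sup>2" for k
        using D by (simp add: J_def bounded_clinear_add bounded_clinear_scaleR norm_add_square
            f_add f_scaleR cinner_scaleR_right power_mult_distrib algebra_simps)
      then have "m \<le> J (y k) + t * (2 * Re (cinner (D (y k)) (D v)) - 2 * Re (f v))
          + t\<^sup>2 * (norm (D v))\<^sup>2" for k
        using m_le by metis
      then have "m \<le> m + t * (2 * Re (cinner z (D v)) - 2 * Re (f v)) + t\<^sup>2 * (norm (D v))\<^sup>2"
        by (intro LIMSEQ_le_const[of "\<lambda>k. J (y k) + t * (2 * Re (cinner (D (y k)) (D v))
              - 2 * Re (f v)) + t\<^sup>2 * (norm (D v))\<^sup>2"])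
          (auto intro!: tendsto_intros Jy z)
      then show ?thesis
        by simp
    qed
    from linear_coeff_zero[OF this] show ?thesis
      by (simp add: Re_cinner_commute)
  qed
  \<comment> \<open>The imaginary part is the real-part identity at
    \<open>\<i> *\<^sub>C v\<close>.\<close>
  have f_eq: "f v = cinner (D v) z" for v
    using Re_f[of v] Re_f[of "\<i> *\<^sub>C v"] D
    by (simp add: complex_eq_iff f_scale bounded_clinear_scaleC cinner_scaleC_left)
  \<comment> \<open>Evaluate \<open>f\<close> along the minimizing sequence: the values tend to
    \<open>cinner z z\<close>, while \<open>f_bound\<close> controls them by
    \<open>C * norm (D (y k))\<close>.\<close>
  have "(norm z)\<^sup>2 \<le> C * norm z"
  proof (rule LIMSEQ_le)
    have "(\<lambda>k. Re (f (y k))) \<longlonglongrightarrow> Re (cinner z z)"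
      unfolding f_eq by (intro tendsto_intros z)
    then show "(\<lambda>k. Re (f (y k))) \<longlonglongrightarrow> (norm z)\<^sup>2"
      by (simp add: Re_cinner_self)
    show "(\<lambda>k. C * norm (D (y k))) \<longlonglongrightarrow> C * norm z"
      by (intro tendsto_intros z)
    show "\<exists>N. \<forall>k\<ge>N. Re (f (y k)) \<le> C * norm (D (y k))"
      using complex_Re_le_cmod f_bound order_trans by blast
  qed
  then have "norm z \<le> C"
    using \<open>C \<ge> 0\<close> by (cases "z = 0") (auto simp: power2_eq_square)
  moreover have "z \<in> closure (range D)"
    using z by (auto simp: closure_sequential intro!: exI[of _ "\<lambda>k. D (y k)"])
  ultimately show ?thesis
    using f_eq by blast
qed


section \<open>Adjoints and real parts\<close>

text \<open>Riesz representation, with the identity as \<open>D\<close>, applied to the bounded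
  functional sending \<open>x\<close> to \<open>cinner (T x) y\<close>.\<close>

lemma cadjoint_exists:
  fixes T :: "'a::chilbert_space \<Rightarrow> 'a"
  assumes T: "bounded_clinear T"
  shows "\<exists>T'. \<forall>x y. cinner (T x) y = cinner x (T' y)"
proof -
  obtain K where K: "K \<ge> 0" "\<And>x. norm (T x) \<le> K * norm x"
    using bounded_clinear_bound[OF T] by blast
  have "\<exists>z. \<forall>x. cinner (T x) y = cinner x z" for y
  proof -
    have "cmod (cinner (T x) y) \<le> K * norm y * norm x" for x
    proof -
      have "cmod (cinner (T x) y) \<le> norm (T x) * norm y"
        by (rule Cauchy_Schwarz)
      also have "\<dots> \<le> K * norm x * norm y"
        using K by (intro mult_right_mono) auto
      finally show ?thesis
        by (simp add: mult_ac)
    qed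
    then have "\<exists>z. z \<in> closure (range (\<lambda>x. x)) \<and> (\<forall>x. cinner (T x) y = cinner x z)
        \<and> norm z \<le> K * norm y"
      by (intro Riesz_relative[OF bounded_clinear_ident])
        (simp_all add: bounded_clinear_add[OF T] bounded_clinear_scaleC[OF T] cinner_add_left
          cinner_scaleC_left K(1))
    then show ?thesis
      by blast
  qed
  then show ?thesis
    by metis
qed

lemma cinner_cadjoint_right:
  assumes "bounded_clinear T"
  shows "cinner x (cadjoint T y) = cinner (T x) y"
proof -
  have "\<exists>!T'. \<forall>x y. cinner (T x) y = cinner x (T' y)"
  proof (rule ex_ex1I[OF cadjoint_exists[OF assms]])
    fix U V
    assume "\<forall>x y. cinner (T x) y = cinner x (U y)" "\<forall>x y. cinner (T x) y = cinner x (V y)"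
    then show "U = V"
      by (metis cinner_right_eqI ext)
  qed
  from theI'[OF this] show ?thesis
    unfolding cadjoint_def by metis
qed

lemma cinner_cadjoint_left: "bounded_clinear T \<Longrightarrow> cinner (cadjoint T x) y = cinner x (T y)"
  by (metis cinner_cadjoint_right cinner_commute)

text \<open>The square of the norm of \<open>cadjoint T x\<close> is the inner product of
  \<open>T (cadjoint T x)\<close> with \<open>x\<close>; bound it by Cauchy-Schwarz and cancel one
  factor.\<close>

lemma norm_cadjoint_le:
  assumes T: "bounded_clinear T" and K: "K \<ge> 0" "\<And>x. norm (T x) \<le> K * norm x"
  shows "norm (cadjoint T x) \<le> K * norm x"
proof -
  have "(norm (cadjoint T x))\<^sup>2 = Re (cinner (T (cadjoint T x)) x)"
    by (simp add: cinner_cadjoint_right[OF T] flip: Re_cinner_self)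
  also have "\<dots> \<le> norm (T (cadjoint T x)) * norm x"
    using complex_Re_le_cmod Cauchy_Schwarz order_trans by blast
  also have "\<dots> \<le> K * norm (cadjoint T x) * norm x"
    using K by (intro mult_right_mono) auto
  finally show ?thesis
    using K(1) by (cases "cadjoint T x = 0") (auto simp: power2_eq_square mult_ac)
qed

lemma bounded_clinear_cadjoint:
  fixes T :: "'a::chilbert_space \<Rightarrow> 'a"
  assumes T: "bounded_clinear T"
  shows "bounded_clinear (cadjoint T)"
proof -
  obtain K where K: "K \<ge> 0" "\<And>x. norm (T x) \<le> K * norm x"
    using bounded_clinear_bound[OF T] by blast
  show ?thesis
    by (rule bounded_clinearI[OF _ _ norm_cadjoint_le[OF T K]];
        rule cinner_right_eqI;
        simp add: cinner_cadjoint_right[OF T] cinner_add_right cinner_scaleC_right)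
qed

lemma bounded_clinear_op_Re: "bounded_clinear A \<Longrightarrow> bounded_clinear (op_Re A)"
  unfolding op_Re_def
  by (intro bounded_clinear_scaledR bounded_clinear_plus bounded_clinear_cadjoint)

lemma cinner_op_Re:
  assumes "bounded_clinear A"
  shows "cinner (op_Re A x) x = of_real (Re (cinner (A x) x))"
proof -
  have "cinner (cadjoint A x) x = cnj (cinner (A x) x)"
    by (metis assms cinner_cadjoint_left cinner_commute)
  then show ?thesis
    by (simp add: op_Re_def cinner_scaleR_left cinner_add_left complex_eq_iff)
qed

section \<open>Positive operators and square roots\<close>

text \<open>Over the complex scalars the quadratic form determines the operator. This yields
  self-adjointness of positive operators and, later, the bound on the off-diagonal form.\<close>

lemma cinner_polarization:
  fixes A :: "'a::chilbert_space \<Rightarrow> 'a"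
  assumes A: "bounded_clinear A"
  shows "4 * cinner (A x) y =
    cinner (A (x + y)) (x + y) - cinner (A (x - y)) (x - y)
    + \<i> * cinner (A (x + \<i> *\<^sub>C y)) (x + \<i> *\<^sub>C y) - \<i> * cinner (A (x - \<i> *\<^sub>C y)) (x - \<i> *\<^sub>C y)"
  by (simp add: bounded_clinear_add[OF A] bounded_clinear_diff[OF A] bounded_clinear_scaleC[OF A]
      cinner_add_left cinner_add_right cinner_diff_left cinner_diff_right cinner_scaleC_left
      cinner_scaleC_right algebra_simps)

text \<open>Since the quadratic form is real, \<open>P\<close> and its adjoint have the same one,
  and polarization identifies them.\<close>

lemma positive_op_selfadjoint:
  assumes "positive_op P"
  shows "cinner (P x) y = cinner x (P y)"
proof -
  have P: "bounded_clinear P" and real: "\<And>x. cinner (P x) x \<in> \<real>"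
    using assms by (auto simp: positive_op_def)
  have eq: "cinner (cadjoint P u) u = cinner (P u) u" for u
    using real[of u] by (metis P Reals_cnj_iff cinner_cadjoint_left cinner_commute)
  have "4 * cinner (P x) y = 4 * cinner (cadjoint P x) y"
    unfolding cinner_polarization[OF P] cinner_polarization[OF bounded_clinear_cadjoint[OF P]] eq ..
  then show ?thesis
    by (simp add: cinner_cadjoint_left[OF P])
qed

text \<open>Such an \<open>x\<close> minimizes the quadratic form. Perturbing it in the direction
  \<open>P x\<close> gives the linear coefficient \<open>2 * (norm (P x))\<^sup>2\<close>, which
  must vanish.\<close>

lemma positive_op_eq_zero:
  assumes "positive_op P" and "Re (cinner (P x) x) = 0"
  shows "P x = 0"
proof -
  have P: "bounded_clinear P" and pos: "\<And>x. 0 \<le> Re (cinner (P x) x)"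
    using assms by (auto simp: positive_op_def)
  have "0 \<le> t * (2 * (norm (P x))\<^sup>2) + t\<^sup>2 * Re (cinner (P (P x)) (P x))" for t
    using pos[of "x + t *\<^sub>R P x"] assms(2) positive_op_selfadjoint[OF assms(1), of "P x" x]
    by (simp add: bounded_clinear_add[OF P] bounded_clinear_scaleR[OF P] cinner_add_left
        cinner_add_right cinner_scaleR_left cinner_scaleR_right cinner_self power2_eq_square
        algebra_simps)
  from linear_coeff_zero[OF this] show ?thesis
    by simp
qed

text \<open>The fixed point iteration for \<open>Y = (B + Y\<^sup>2) / 2\<close>, i.e. \<open>(I - Y)\<^sup>2 = I - B\<close>. It is dominated
  by its scalar counterpart with \<open>B = 1\<close>, which increases and is bounded by \<open>1\<close>.\<close>

fun sqrt_iter :: "('a::chilbert_space \<Rightarrow> 'a) \<Rightarrow> nat \<Rightarrow> 'a \<Rightarrow> 'a" where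
  "sqrt_iter B 0 = (\<lambda>x. 0)"
| "sqrt_iter B (Suc k) = (\<lambda>x. (1/2) *\<^sub>R (B x + sqrt_iter B k (sqrt_iter B k x)))"

fun sqrt_bound :: "nat \<Rightarrow> real" where
  "sqrt_bound 0 = 0"
| "sqrt_bound (Suc k) = (1 + (sqrt_bound k)\<^sup>2) / 2"

lemma sqrt_bound_range: "0 \<le> sqrt_bound k \<and> sqrt_bound k \<le> 1"
  by (induction k) (auto simp: power_le_one)

lemma sqrt_bound_mono: "incseq sqrt_bound"
proof (rule incseq_SucI)
  show "sqrt_bound k \<le> sqrt_bound (Suc k)" for k
    by (induction k) (use sqrt_bound_range in \<open>simp_all add: power_mono\<close>)
qed

section \<open>Convergence of the iteration and uniqueness of the positive square root of
  \<open>I - B\<close>\<close>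

locale norm_one_selfadjoint =
  fixes B :: "'a::chilbert_space \<Rightarrow> 'a"
  assumes B: "bounded_clinear B"
    and B_bound: "norm (B x) \<le> norm x"
    and B_sym: "cinner (B x) y = cinner x (B y)"
begin

abbreviation Y where "Y \<equiv> sqrt_iter B"

lemma Y_clinear: "bounded_clinear (Y k)"
proof (induction k)
  case (Suc k)
  then show ?case
    unfolding sqrt_iter.simps
    by (intro bounded_clinear_scaledR bounded_clinear_plus[OF B] bounded_clinear_compose[OF Suc Suc])
qed (simp add: bounded_clinear_null)

text \<open>Every iterate is a polynomial in \<open>B\<close>, so it commutes with whatever commutes
  with \<open>B\<close>.\<close>

lemma Y_commute:
  assumes C: "bounded_clinear C" and "\<And>x. C (B x) = B (C x)"
  shows "C (Y k x) = Y k (C x)"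
  by (induction k arbitrary: x)
    (simp_all add: assms bounded_clinear_zero[OF C] bounded_clinear_scaleR[OF C]
      bounded_clinear_add[OF C])

lemma Y_Y_commute: "Y j (Y k x) = Y k (Y j x)"
  by (rule Y_commute[OF Y_clinear]) (rule Y_commute[OF B refl, symmetric])

lemma Y_sym: "cinner (Y k x) y = cinner x (Y k y)"
  by (induction k arbitrary: x y)
    (simp_all add: cinner_scaleR_left cinner_scaleR_right cinner_add_left cinner_add_right B_sym)

lemma Y_bound: "norm (Y k x) \<le> sqrt_bound k * norm x"
proof (induction k arbitrary: x)
  case (Suc k)
  have "norm (Y k (Y k x)) \<le> sqrt_bound k * (sqrt_bound k * norm x)"
    using Suc[of "Y k x"] mult_left_mono[OF Suc[of x], of "sqrt_bound k"] sqrt_bound_range[of k]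
    by linarith
  then have "norm (B x + Y k (Y k x)) \<le> norm x + sqrt_bound k * (sqrt_bound k * norm x)"
    using norm_triangle_ineq[of "B x" "Y k (Y k x)"] B_bound[of x] by linarith
  moreover have "norm (Y (Suc k) x) = norm (B x + Y k (Y k x)) / 2"
    unfolding sqrt_iter.simps norm_scaleR by simp
  ultimately show ?case
    by (simp add: power2_eq_square algebra_simps del: sqrt_iter.simps)
qed simp

text \<open>Successive differences satisfy the same recursion as those of the scalar sequence, half
  a difference of squares, so the scalar increments dominate them by induction.\<close>

lemma Y_step: "norm (Y (Suc k) x - Y k x) \<le> (sqrt_bound (Suc k) - sqrt_bound k) * norm x"
proof (induction k arbitrary: x)
  case 0
  then show ?case
    using B_bound[of x] by simp
next
  case (Suc k)
  let ?u = "Y (Suc k) x + Y k x" and ?r = "sqrt_bound (Suc k)" and ?s = "sqrt_bound k"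
  have bound_diff: "sqrt_bound (Suc (Suc k)) - ?r = (1 + ?r\<^sup>2) / 2 - (1 + ?s\<^sup>2) / 2"
    by simp
  have "Y (Suc (Suc k)) x - Y (Suc k) x = (1/2) *\<^sub>R (Y (Suc k) (Y (Suc k) x) - Y k (Y k x))"
    unfolding sqrt_iter.simps(2)[of B "Suc k"] scaleR_diff_right
    by (subst (3) sqrt_iter.simps(2)) (simp add: scaleR_add_right del: sqrt_iter.simps)
  \<comment> \<open>The iterates commute, so the difference of squares factors as
    \<open>Y (Suc k) - Y k\<close> applied to the sum \<open>?u\<close>.\<close>
  also have "\<dots> = (1/2) *\<^sub>R (Y (Suc k) ?u - Y k ?u)"
    by (simp add: bounded_clinear_add[OF Y_clinear] Y_Y_commute[of k "Suc k"] del: sqrt_iter.simps)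
  finally have "norm (Y (Suc (Suc k)) x - Y (Suc k) x) = norm (Y (Suc k) ?u - Y k ?u) / 2"
    by (simp del: sqrt_iter.simps)
  also have "\<dots> \<le> (?r - ?s) * norm ?u / 2"
    by (intro divide_right_mono Suc) simp
  also have "\<dots> \<le> (?r - ?s) * ((?r + ?s) * norm x) / 2"
  proof (intro divide_right_mono mult_left_mono)
    show "norm ?u \<le> (?r + ?s) * norm x"
      using norm_triangle_ineq[of "Y (Suc k) x" "Y k x"] Y_bound[of "Suc k" x] Y_bound[of k x]
      by (simp add: algebra_simps del: sqrt_iter.simps sqrt_bound.simps)
    show "0 \<le> ?r - ?s"
      using incseq_SucD[OF sqrt_bound_mono, of k] by simp
  qed simp
  also have "\<dots> = (sqrt_bound (Suc (Suc k)) - sqrt_bound (Suc k)) * norm x"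
    unfolding bound_diff by (simp add: field_simps power2_eq_square del: sqrt_bound.simps)
  finally show ?case .
qed

lemma Y_diff: "j \<le> k \<Longrightarrow> norm (Y k x - Y j x) \<le> (sqrt_bound k - sqrt_bound j) * norm x"
proof (induction k rule: dec_induct)
  case (step k)
  then show ?case
    using Y_step[of k x] norm_triangle_ineq[of "Y (Suc k) x - Y k x" "Y k x - Y j x"]
    by (simp add: algebra_simps del: sqrt_iter.simps sqrt_bound.simps)
qed simp

text \<open>The bounded increasing scalar sequence converges, and its increments dominate those of
  the iterates at each vector. Convergence is therefore obtained pointwise, in the strong operator
  topology.\<close>

lemma Y_convergent: "convergent (\<lambda>k. Y k x)"
proof -
  have "convergent sqrt_bound"
    using sqrt_bound_range sqrt_bound_mono
    by (intro Bseq_mono_convergent) (auto simp: incseq_def intro!: BseqI'[of _ 1])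
  then have "Cauchy (\<lambda>k. sqrt_bound k * norm x)"
    by (intro convergent_Cauchy convergent_mult convergent_const)
  moreover have "dist (Y i x) (Y j x) \<le> dist (sqrt_bound i * norm x) (sqrt_bound j * norm x)" for i j
    using Y_diff[of i j x] Y_diff[of j i x]
    by (cases "i \<le> j") (auto simp: dist_norm norm_minus_commute left_diff_distrib)
  ultimately have "Cauchy (\<lambda>k. Y k x)"
    unfolding Cauchy_def by (meson le_less_trans)
  then show ?thesis
    by (simp add: Cauchy_convergent_iff)
qed

definition Yinf where "Yinf x = lim (\<lambda>k. Y k x)"

lemma Yinf: "(\<lambda>k. Y k x) \<longlonglongrightarrow> Yinf x"
  using Y_convergent unfolding Yinf_def by (simp add: convergent_LIMSEQ_iff)

lemma Yinf_bound: "norm (Yinf x) \<le> norm x"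
proof (rule LIMSEQ_le_const2)
  show "(\<lambda>k. norm (Y k x)) \<longlonglongrightarrow> norm (Yinf x)"
    by (intro tendsto_intros Yinf)
  have "norm (Y k x) \<le> norm x" for k
    using Y_bound[of k x] mult_right_mono[of "sqrt_bound k" 1 "norm x"] sqrt_bound_range[of k]
    by simp
  then show "\<exists>N. \<forall>k\<ge>N. norm (Y k x) \<le> norm x"
    by blast
qed

lemma Yinf_clinear: "bounded_clinear Yinf"
proof (rule bounded_clinearI)
  fix x y c
  show "Yinf (x + y) = Yinf x + Yinf y"
    using LIMSEQ_unique[OF Yinf, of "x + y"] tendsto_add[OF Yinf Yinf, of x y]
    by (simp add: bounded_clinear_add[OF Y_clinear])
  show "Yinf (c *\<^sub>C x) = c *\<^sub>C Yinf x"
    using LIMSEQ_unique[OF Yinf, of "c *\<^sub>C x"]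
      bounded_linear.tendsto[OF bounded_linear_scaleC Yinf, of c x]
    by (simp add: bounded_clinear_scaleC[OF Y_clinear])
  show "norm (Yinf x) \<le> 1 * norm x"
    using Yinf_bound by simp
qed

lemma Yinf_commute:
  assumes C: "bounded_clinear C" and "\<And>x. C (B x) = B (C x)"
  shows "C (Yinf x) = Yinf (C x)"
  using LIMSEQ_unique[OF Yinf, of "C x"] tendsto_bounded_clinear[OF C Yinf, of x]
  by (simp add: Y_commute[OF assms])

lemma Yinf_sym: "cinner (Yinf x) y = cinner x (Yinf y)"
proof (rule LIMSEQ_unique)
  show "(\<lambda>k. cinner (Y k x) y) \<longlonglongrightarrow> cinner (Yinf x) y"
    by (intro tendsto_intros Yinf)
  show "(\<lambda>k. cinner (Y k x) y) \<longlonglongrightarrow> cinner x (Yinf y)"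
    unfolding Y_sym by (intro tendsto_intros Yinf)
qed

lemma Yinf_fixed_point: "2 *\<^sub>R Yinf x = B x + Yinf (Yinf x)"
proof (rule LIMSEQ_unique)
  show "(\<lambda>k. 2 *\<^sub>R Y (Suc k) x) \<longlonglongrightarrow> 2 *\<^sub>R Yinf x"
    by (intro tendsto_intros LIMSEQ_Suc Yinf)
  \<comment> \<open>In \<open>Y k (Y k x)\<close> both the operator and its argument vary. Splitting
    off \<open>Y k (Yinf x)\<close> leaves this term, which vanishes because all \<open>Y k\<close>
    have norm at most 1.\<close>
  have "(\<lambda>k. Y k (Y k x - Yinf x)) \<longlonglongrightarrow> 0"
  proof (rule tendsto_norm_zero_cancel, rule tendsto_sandwich[OF _ _ tendsto_const])
    have "norm (Y k (Y k x - Yinf x)) \<le> norm (Y k x - Yinf x)" for k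
      using Y_bound[of k "Y k x - Yinf x"] sqrt_bound_range[of k]
        mult_right_mono[of "sqrt_bound k" 1 "norm (Y k x - Yinf x)"] by simp
    then show "\<forall>\<^sub>F k in sequentially. norm (Y k (Y k x - Yinf x)) \<le> norm (Y k x - Yinf x)"
      by simp
    show "(\<lambda>k. norm (Y k x - Yinf x)) \<longlonglongrightarrow> 0"
      using Yinf[of x] by (simp add: LIM_zero_iff tendsto_norm_zero_iff)
  qed simp
  then have "(\<lambda>k. Y k (Y k x - Yinf x) + Y k (Yinf x)) \<longlonglongrightarrow> 0 + Yinf (Yinf x)"
    by (intro tendsto_add Yinf)
  then have "(\<lambda>k. B x + Y k (Y k x)) \<longlonglongrightarrow> B x + Yinf (Yinf x)"
    by (intro tendsto_intros) (simp add: bounded_clinear_diff[OF Y_clinear])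
  then show "(\<lambda>k. 2 *\<^sub>R Y (Suc k) x) \<longlonglongrightarrow> B x + Yinf (Yinf x)"
    by simp
qed

definition R where "R x = x - Yinf x"

lemma R_clinear: "bounded_clinear R"
  unfolding R_def[abs_def] by (intro bounded_clinear_minus bounded_clinear_ident Yinf_clinear)

text \<open>\<open>Yinf\<close> is self-adjoint and has norm at most 1, so its quadratic form is
  real and at most that of the identity.\<close>

lemma R_positive: "positive_op R"
  unfolding positive_op_def
proof (intro conjI allI R_clinear)
  fix x
  have "cnj (cinner (Yinf x) x) = cinner (Yinf x) x"
    by (metis Yinf_sym cinner_commute)
  then show "cinner (R x) x \<in> \<real>"
    by (simp add: Reals_cnj_iff R_def cinner_diff_left cinner_self)
  have "Re (cinner (Yinf x) x) \<le> norm (Yinf x) * norm x"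
    using complex_Re_le_cmod Cauchy_Schwarz order_trans by blast
  also have "\<dots> \<le> norm x * norm x"
    by (intro mult_right_mono Yinf_bound) simp
  finally show "0 \<le> Re (cinner (R x) x)"
    by (simp add: R_def cinner_diff_left cinner_self power2_eq_square)
qed

lemma R_square: "R (R x) = x - B x"
  using Yinf_fixed_point[of x]
  by (simp add: R_def bounded_clinear_diff[OF Yinf_clinear] scaleR_2 algebra_simps)

text \<open>\<open>C\<close> commutes with its square, hence with \<open>B\<close> and with
  \<open>R\<close>, so \<open>R + C\<close> annihilates \<open>y = R x - C x\<close>. Positivity
  then forces \<open>R y = 0\<close> and \<open>C y = 0\<close>, and self-adjointness gives
  \<open>cinner y y = 0\<close>.\<close>

lemma R_unique:
  assumes pos: "positive_op C" and square: "\<And>x. C (C x) = x - B x"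
  shows "C = R"
proof
  fix x
  have C: "bounded_clinear C"
    using pos by (simp add: positive_op_def)
  have "B x = x - C (C x)" for x
    by (simp add: square)
  then have "C (B x) = B (C x)" for x
    by (simp add: bounded_clinear_diff[OF C])
  then have comm: "C (R x) = R (C x)" for x
    by (simp add: R_def bounded_clinear_diff[OF C] Yinf_commute[OF C])
  define y where "y = R x - C x"
  have "R y + C y = R (R x) - C (C x)"
    by (simp add: y_def bounded_clinear_diff[OF C] bounded_clinear_diff[OF R_clinear] comm)
  then have "R y + C y = 0"
    by (simp add: R_square square)
  then have "Re (cinner (R y) y) + Re (cinner (C y) y) = 0"
    by (metis cinner_add_left cinner_zero_left plus_complex.sel(1) zero_complex.sel(1))
  moreover have "0 \<le> Re (cinner (R y) y)" "0 \<le> Re (cinner (C y) y)"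
    using pos R_positive by (auto simp: positive_op_def)
  ultimately have "R y = 0" "C y = 0"
    using positive_op_eq_zero[OF R_positive, of y] positive_op_eq_zero[OF pos, of y] by simp_all
  then have "cinner y (R x - C x) = 0"
    by (simp add: cinner_diff_right positive_op_selfadjoint[OF pos, symmetric]
        positive_op_selfadjoint[OF R_positive, symmetric])
  then have "cinner y y = 0"
    by (simp add: y_def)
  then show "C x = R x"
    by (simp add: y_def cinner_self)
qed

lemma op_sqrt_eq: "op_sqrt (\<lambda>x. x - B x) = R"
  unfolding op_sqrt_def
proof (rule the_equality)
  show "positive_op R \<and> R \<circ> R = (\<lambda>x. x - B x)"
    by (auto simp: R_positive R_square)
  show "C = R" if "positive_op C \<and> C \<circ> C = (\<lambda>x. x - B x)" for C
    using that by (intro R_unique) (simp_all add: fun_eq_iff)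
qed

end

section \<open>The defect operator\<close>

lemma contraction_norm_one_selfadjoint:
  assumes "contraction T"
  shows "norm_one_selfadjoint (\<lambda>x. cadjoint T (T x))"
proof
  have T: "bounded_clinear T" and bound: "\<And>x. norm (T x) \<le> norm x"
    using assms by (auto simp: contraction_def)
  show "bounded_clinear (\<lambda>x. cadjoint T (T x))"
    by (rule bounded_clinear_compose[OF bounded_clinear_cadjoint[OF T] T])
  show "norm (cadjoint T (T x)) \<le> norm x" for x
    using norm_cadjoint_le[OF T, of 1 "T x"] bound order_trans by fastforce
  show "cinner (cadjoint T (T x)) y = cinner x (cadjoint T (T y))" for x y
    by (simp add: cinner_cadjoint_left[OF T] cinner_cadjoint_right[OF T])
qed

lemma defect_op_positive: "contraction T \<Longrightarrow> positive_op (defect_op T)"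
  unfolding defect_op_def
  by (simp add: norm_one_selfadjoint.op_sqrt_eq norm_one_selfadjoint.R_positive
      contraction_norm_one_selfadjoint)

lemma defect_op_square: "contraction T \<Longrightarrow> defect_op T (defect_op T x) = x - cadjoint T (T x)"
  unfolding defect_op_def
  by (simp add: norm_one_selfadjoint.op_sqrt_eq norm_one_selfadjoint.R_square
      contraction_norm_one_selfadjoint)

lemma bounded_clinear_defect_op: "contraction T \<Longrightarrow> bounded_clinear (defect_op T)"
  using defect_op_positive by (auto simp: positive_op_def)

lemma defect_op_selfadjoint:
  "contraction T \<Longrightarrow> cinner (defect_op T x) y = cinner x (defect_op T y)"
  by (intro positive_op_selfadjoint defect_op_positive)

text \<open>Move one factor of the square of the defect operator to the other side. This rewrites
  the right-hand form of the second condition as a multiple of the squared norm of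
  \<open>D x\<close>.\<close>

lemma norm_defect_op:
  assumes "contraction T"
  shows "(norm (defect_op T x))\<^sup>2 = Re (cinner (x - cadjoint T (T x)) x)"
  using defect_op_selfadjoint[OF assms, of "defect_op T x" x]
  by (simp add: defect_op_square[OF assms] Re_cinner_self)

section \<open>Factorization through the defect operator\<close>

text \<open>Polarization and the parallelogram law bound the form by a sum of squares. Replacing
  \<open>x\<close> by \<open>t x\<close> and \<open>y\<close> by \<open>y / t\<close> leaves the
  form unchanged, and optimizing over \<open>t\<close> turns the sum into a product.\<close>

lemma form_bound:
  fixes A D :: "'a::chilbert_space \<Rightarrow> 'a"
  assumes A: "bounded_clinear A" and D: "bounded_clinear D" and "w \<ge> 0"
    and le: "\<And>x. cmod (cinner (A x) x) \<le> w * (norm (D x))\<^sup>2"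
  shows "cmod (cinner (A x) y) \<le> 2 * w * (norm (D x) * norm (D y))"
proof -
  have sum: "cmod (cinner (A x) y) \<le> w * ((norm (D x))\<^sup>2 + (norm (D y))\<^sup>2)" for x y
  proof -
    let ?q = "\<lambda>u. cinner (A u) u"
    have "4 * cmod (cinner (A x) y) = cmod (4 * cinner (A x) y)"
      by (simp add: norm_mult)
    also have "\<dots> \<le> cmod (?q (x + y)) + cmod (?q (x - y))
        + cmod (?q (x + \<i> *\<^sub>C y)) + cmod (?q (x - \<i> *\<^sub>C y))"
    proof -
      have "cmod (a - b + \<i> * c - \<i> * d) \<le> cmod a + cmod b + cmod c + cmod d" for a b c d
        using norm_triangle_ineq4[of "a - b + \<i> * c" "\<i> * d"]
          norm_triangle_ineq[of "a - b" "\<i> * c"] norm_triangle_ineq4[of a b]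
        by (simp add: norm_mult)
      then show ?thesis
        unfolding cinner_polarization[OF A] .
    qed
    also have "\<dots> \<le> w * (norm (D (x + y)))\<^sup>2 + w * (norm (D (x - y)))\<^sup>2
        + w * (norm (D (x + \<i> *\<^sub>C y)))\<^sup>2 + w * (norm (D (x - \<i> *\<^sub>C y)))\<^sup>2"
      by (intro add_mono le)
    also have "\<dots> = w * ((norm (D x + D y))\<^sup>2 + (norm (D x + - D y))\<^sup>2
        + (norm (D x + \<i> *\<^sub>C D y))\<^sup>2 + (norm (D x + - (\<i> *\<^sub>C D y)))\<^sup>2)"
      by (simp add: bounded_clinear_add[OF D] bounded_clinear_diff[OF D]
          bounded_clinear_scaleC[OF D] algebra_simps)
    also have "\<dots> = 4 * (w * ((norm (D x))\<^sup>2 + (norm (D y))\<^sup>2))"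
      unfolding norm_add_square
      by (simp add: cinner_minus_right cinner_scaleC_right norm_scaleC algebra_simps)
    finally show ?thesis
      by simp
  qed
  have scaled: "cmod (cinner (A x) y) \<le> w * (t\<^sup>2 * (norm (D x))\<^sup>2 + (norm (D y))\<^sup>2 / t\<^sup>2)"
    if "t > 0" for t
    using sum[of "t *\<^sub>R x" "(1/t) *\<^sub>R y"] that
    by (simp add: bounded_clinear_scaleR[OF A] bounded_clinear_scaleR[OF D] cinner_scaleR_left
        cinner_scaleR_right power_mult_distrib power_divide)
  \<comment> \<open>There is no optimal \<open>t > 0\<close> when \<open>D x = 0\<close> or \<open>D y = 0\<close>; perturbing the norms by \<open>e\<close>
    avoids these cases.\<close>
  have "cmod (cinner (A x) y) \<le> 2 * w * ((norm (D x) + e) * (norm (D y) + e))" if "e > 0" for e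
  proof -
    define a b where "a = norm (D x) + e" and "b = norm (D y) + e"
    have ab: "a > 0" "b > 0" "norm (D x) \<le> a" "norm (D y) \<le> b"
      using that by (auto simp: a_def b_def add_nonneg_pos)
    \<comment> \<open>The value \<open>t\<^sup>2 = b / a\<close> minimizes
      \<open>t\<^sup>2 * a\<^sup>2 + b\<^sup>2 / t\<^sup>2\<close>, with minimum
      \<open>2 * a * b\<close>.\<close>
    have "cmod (cinner (A x) y) \<le> w * ((b / a) * (norm (D x))\<^sup>2 + (norm (D y))\<^sup>2 / (b / a))"
      using scaled[of "sqrt (b / a)"] ab by simp
    also have "\<dots> \<le> w * ((b / a) * a\<^sup>2 + b\<^sup>2 / (b / a))"
      using ab \<open>w \<ge> 0\<close>
      by (intro mult_left_mono add_mono divide_right_mono power_mono) simp_all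
    also have "\<dots> = 2 * w * (a * b)"
      using ab by (simp add: power2_eq_square)
    finally show ?thesis
      by (simp add: a_def b_def)
  qed
  then have "cmod (cinner (A x) y)
      \<le> 2 * w * ((norm (D x) + 1 / real (Suc k)) * (norm (D y) + 1 / real (Suc k)))" for k
    by simp
  moreover have "(\<lambda>k. 2 * w * ((norm (D x) + 1 / real (Suc k)) * (norm (D y) + 1 / real (Suc k))))
      \<longlonglongrightarrow> 2 * w * ((norm (D x) + 0) * (norm (D y) + 0))"
    using LIMSEQ_inverse_real_of_nat by (intro tendsto_intros) (simp_all add: inverse_eq_divide)
  ultimately show ?thesis
    by (intro LIMSEQ_le_const) auto
qed

text \<open>Write the form as \<open>\<langle>D x, W y\<rangle>\<close> and then, for fixed \<open>u\<close>, the functional \<open>\<langle>u, W y\<rangle>\<close> of \<open>y\<close> as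
  \<open>\<langle>X u, D y\<rangle>\<close>, using the relative Riesz theorem both times.\<close>

lemma factorization:
  fixes A D :: "'a::chilbert_space \<Rightarrow> 'a"
  assumes A: "bounded_clinear A" and D: "bounded_clinear D"
    and D_sym: "\<And>x y. cinner (D x) y = cinner x (D y)" and "C \<ge> 0"
    and bound: "\<And>x y. cmod (cinner (A x) y) \<le> C * (norm (D x) * norm (D y))"
  obtains X where "bounded_clinear X" "\<And>u. X u \<in> closure (range D)" "\<And>x. A x = D (X (D x))"
proof -
  have "\<exists>z. z \<in> closure (range D) \<and> (\<forall>x. cinner (A x) y = cinner (D x) z) \<and> norm z \<le> C * norm (D y)"
    for y
    by (rule Riesz_relative[OF D])
      (use bound \<open>C \<ge> 0\<close> in \<open>simp_all add: bounded_clinear_add[OF A] bounded_clinear_scaleC[OF A]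
        cinner_add_left cinner_scaleC_left mult_ac\<close>)
  then obtain W where W_in: "\<And>y. W y \<in> closure (range D)"
    and W: "\<And>x y. cinner (A x) y = cinner (D x) (W y)"
    and W_norm: "\<And>y. norm (W y) \<le> C * norm (D y)"
    by metis
  \<comment> \<open>Linearity is inherited from the form, because representing vectors in the
    closure of the range are unique.\<close>
  have W_add: "W (x + y) = W x + W y" for x y
    by (rule closure_range_eqI[OF D W_in closure_range_add[OF D W_in W_in]])
      (simp add: cinner_add_right flip: W)
  have W_scaleC: "W (c *\<^sub>C y) = c *\<^sub>C W y" for c y
    by (rule closure_range_eqI[OF D W_in closure_range_scaleC[OF D W_in]])
      (simp add: cinner_scaleC_right flip: W)
  have "\<exists>z. z \<in> closure (range D) \<and> (\<forall>y. cinner (W y) u = cinner (D y) z) \<and> norm z \<le> C * norm u"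
    for u
  proof -
    have "cmod (cinner (W y) u) \<le> C * norm u * norm (D y)" for y
      using Cauchy_Schwarz[of "W y" u] mult_right_mono[OF W_norm[of y], of "norm u"]
      by (simp add: mult_ac)
    then show ?thesis
      using \<open>C \<ge> 0\<close> by (intro Riesz_relative[OF D])
        (simp_all add: W_add W_scaleC cinner_add_left cinner_scaleC_left)
  qed
  then obtain X where X_in: "\<And>u. X u \<in> closure (range D)"
    and X: "\<And>u y. cinner (W y) u = cinner (D y) (X u)"
    and X_norm: "\<And>u. norm (X u) \<le> C * norm u"
    by metis
  have "X (x + y) = X x + X y" for x y
    by (rule closure_range_eqI[OF D X_in closure_range_add[OF D X_in X_in]])
      (simp add: cinner_add_right flip: X)
  moreover have "X (c *\<^sub>C y) = c *\<^sub>C X y" for c y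
    by (rule closure_range_eqI[OF D X_in closure_range_scaleC[OF D X_in]])
      (simp add: cinner_scaleC_right flip: X)
  ultimately have "bounded_clinear X"
    using X_norm by (rule bounded_clinearI)
  \<comment> \<open>Pairing with \<open>y\<close>: the form \<open>cinner (A x) y\<close> equals
    \<open>cinner (D x) (W y)\<close>, then \<open>cinner (X (D x)) (D y)\<close> by conjugating
    \<open>X\<close>, and \<open>D_sym\<close> moves the last \<open>D\<close> to the left.\<close>
  moreover have "A x = D (X (D x))" for x
    by (rule cinner_right_eqI) (metis D_sym W X cinner_commute)
  ultimately show ?thesis
    using that X_in by blast
qed

section \<open>Numerical radius estimates and the operator inequality\<close>

lemma numerical_radius_on_bound:
  assumes X: "bounded_clinear_on M X"
    and M: "\<And>c x. x \<in> M \<Longrightarrow> c *\<^sub>C x \<in> M" and u: "u \<in> M"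
  shows "cmod (cinner (X u) u) \<le> numerical_radius_on M X * (norm u)\<^sup>2"
proof (cases "u = 0")
  case False
  obtain K where K: "\<And>x. x \<in> M \<Longrightarrow> norm (X x) \<le> K * norm x"
    using X unfolding bounded_clinear_on_def by blast
  have "cmod (cinner (X x) x) \<le> K" if "x \<in> M" "norm x = 1" for x
    using Cauchy_Schwarz[of "X x" x] K[OF that(1)] that(2) by simp
  \<comment> \<open>Boundedness of \<open>X\<close> makes the supremum genuine;
    \<open>max 0 K\<close> also covers the adjoined 0.\<close>
  then have bdd: "bdd_above (insert 0 {cmod (cinner (X x) x) | x. x \<in> M \<and> norm x = 1})"
    by (intro bdd_aboveI[of _ "max 0 K"]) (auto simp: le_max_iff_disj)
  let ?c = "complex_of_real (1 / norm u)"
  have "?c *\<^sub>C u \<in> M" "norm (?c *\<^sub>C u) = 1"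
    using False M[OF u] by (simp_all add: norm_scaleC norm_divide)
  then have "cmod (cinner (X (?c *\<^sub>C u)) (?c *\<^sub>C u)) \<le> numerical_radius_on M X"
    unfolding numerical_radius_on_def by (intro cSup_upper bdd) blast
  moreover have "X (?c *\<^sub>C u) = ?c *\<^sub>C X u"
    using X u by (simp add: bounded_clinear_on_def)
  ultimately have "cmod (cinner (X u) u) / (norm u)\<^sup>2 \<le> numerical_radius_on M X"
    by (simp add: cinner_scaleC_left cinner_scaleC_right norm_mult norm_divide power2_eq_square)
  then show ?thesis
    using False by (simp add: divide_le_eq)
qed simp

text \<open>The quadratic estimate is known on the range of \<open>D\<close> and passes to the
  closure by continuity of \<open>X\<close> there.\<close>

lemma numerical_radius_on_closure_range_le:
  fixes D X :: "'a::chilbert_space \<Rightarrow> 'a"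
  assumes X: "bounded_clinear_on (closure (range D)) X" and D: "bounded_clinear D" and "w \<ge> 0"
    and le: "\<And>x. cmod (cinner (X (D x)) (D x)) \<le> w * (norm (D x))\<^sup>2"
  shows "numerical_radius_on (closure (range D)) X \<le> w"
proof -
  have "cmod (cinner (X u) u) \<le> w" if u: "u \<in> closure (range D)" "norm u = 1" for u
  proof -
    obtain K where K: "\<And>x. x \<in> closure (range D) \<Longrightarrow> norm (X x) \<le> K * norm x"
      using X unfolding bounded_clinear_on_def by blast
    obtain y where y: "\<And>k. y k \<in> range D" "y \<longlonglongrightarrow> u"
      using u(1) by (auto simp: closure_sequential)
    have in_cl: "y k \<in> closure (range D)" for k
      using y(1)[of k] closure_subset[of "range D"] by (rule subsetD[rotated])
    \<comment> \<open>\<open>X\<close> is known to be additive and bounded only on the closure, so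
      the difference \<open>y k - u\<close> must be kept inside it.\<close>
    have "norm (X (y k) - X u) \<le> K * norm (y k - u)" for k
    proof -
      have mem: "y k - u \<in> closure (range D)"
        by (rule closure_range_diff[OF D in_cl u(1)])
      then have "X (y k - u + u) = X (y k - u) + X u"
        using X u(1) unfolding bounded_clinear_on_def by blast
      then show ?thesis
        using K[OF mem] by simp
    qed
    moreover have "(\<lambda>k. K * norm (y k - u)) \<longlonglongrightarrow> 0"
      using tendsto_mult_right_zero[OF tendsto_norm_zero[OF LIM_zero[OF y(2)]]] .
    ultimately have "(\<lambda>k. X (y k) - X u) \<longlonglongrightarrow> 0"
      by (rule Lim_null_comparison[OF always_eventually[rule_format]])
    then have Xy: "(\<lambda>k. X (y k)) \<longlonglongrightarrow> X u"
      by (rule LIM_zero_cancel)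
    have "cmod (cinner (X u) u) \<le> w * (norm u)\<^sup>2"
    proof (rule LIMSEQ_le)
      show "(\<lambda>k. cmod (cinner (X (y k)) (y k))) \<longlonglongrightarrow> cmod (cinner (X u) u)"
        by (intro tendsto_intros Xy y)
      show "(\<lambda>k. w * (norm (y k))\<^sup>2) \<longlonglongrightarrow> w * (norm u)\<^sup>2"
        by (intro tendsto_intros y)
      have "cmod (cinner (X (y k)) (y k)) \<le> w * (norm (y k))\<^sup>2" for k
        using y(1)[of k] le by auto
      then show "\<exists>N. \<forall>k\<ge>N. cmod (cinner (X (y k)) (y k)) \<le> w * (norm (y k))\<^sup>2"
        by blast
    qed
    then show ?thesis
      using u(2) by simp
  qed
  then show ?thesis
    unfolding numerical_radius_on_def using \<open>w \<ge> 0\<close> by (intro cSup_least) auto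
qed

text \<open>Boundedness of the difference and reality of its quadratic form are automatic for
  bounded \<open>A\<close> and \<open>T\<close>, so only the numerical inequality remains.\<close>

lemma op_le_op_Re_iff:
  assumes A: "bounded_clinear A" and T: "bounded_clinear T"
  shows "op_le (op_Re (\<lambda>x. c *\<^sub>C A x)) (\<lambda>x. w *\<^sub>R (x - cadjoint T (T x))) \<longleftrightarrow>
    (\<forall>x. Re (c * cinner (A x) x) \<le> w * Re (cinner (x - cadjoint T (T x)) x))"
proof -
  have cA: "bounded_clinear (\<lambda>x. c *\<^sub>C A x)"
    by (rule bounded_clinear_scaledC[OF A])
  have "bounded_clinear (\<lambda>x. w *\<^sub>R (x - cadjoint T (T x)) - op_Re (\<lambda>x. c *\<^sub>C A x) x)"
    by (intro bounded_clinear_minus bounded_clinear_scaledR bounded_clinear_ident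
        bounded_clinear_compose[OF bounded_clinear_cadjoint] bounded_clinear_op_Re cA T)
  moreover have "cinner (cadjoint T (T x)) x = of_real ((norm (T x))\<^sup>2)" for x
    by (simp add: cinner_cadjoint_left[OF T] cinner_self)
  ultimately show ?thesis
    by (simp add: op_le_def positive_op_def cinner_diff_left cinner_op_Re[OF cA]
        cinner_scaleR_left cinner_scaleC_left cinner_self)
qed

section \<open>Equivalence of the radius bounds and the rotated inequalities\<close>

theorem lemma6p1:
  fixes S :: "nat \<Rightarrow> 'a::chilbert_space \<Rightarrow> 'a" and n :: nat and w :: "nat \<Rightarrow> real"
  assumes "n \<ge> 2" and "w n > 0"
    and "\<And>i. i \<in> {1..n} \<Longrightarrow> bounded_clinear (S i)"
  shows "(AY n S \<and>
          (\<forall>i\<in>{1..n-1}. \<forall>X. is_fundamental_op n S i X \<longrightarrow>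
             numerical_radius_on (defect_space (S n)) X \<le> w n))
     \<longleftrightarrow>
         (\<forall>\<theta>\<in>{0..<2*pi}. \<forall>i\<in>{1..n-1}.
            op_le (op_Re (\<lambda>x. exp (\<i> * complex_of_real \<theta>) *\<^sub>C
                                (S i x - cadjoint (S (n - i)) (S n x))))
                  (\<lambda>x. w n *\<^sub>R (x - cadjoint (S n) (S n x))))"
  (is "?AY \<and> ?rad \<longleftrightarrow> ?pos")
proof -
  let ?D = "defect_op (S n)"
  let ?q = "\<lambda>x. Re (cinner (x - cadjoint (S n) (S n x)) x)"
  define A where "A i x = S i x - cadjoint (S (n - i)) (S n x)" for i x
  have Sn: "bounded_clinear (S n)"
    using assms(1,3) by simp
  have A: "bounded_clinear (A i)" if "i \<in> {1..n-1}" for i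
    using that assms(1,3) unfolding A_def[abs_def]
    by (intro bounded_clinear_minus bounded_clinear_compose[OF bounded_clinear_cadjoint]) auto
  have pos_iff: "?pos \<longleftrightarrow> (\<forall>i\<in>{1..n-1}. \<forall>x. cmod (cinner (A i x) x) \<le> w n * ?q x)"
  proof -
    have "?pos \<longleftrightarrow> (\<forall>\<theta>\<in>{0..<2*pi}. \<forall>i\<in>{1..n-1}. \<forall>x.
        Re (exp (\<i> * complex_of_real \<theta>) * cinner (A i x) x) \<le> w n * ?q x)"
      using A op_le_op_Re_iff[OF _ Sn] unfolding A_def[abs_def] by (intro ball_cong refl) auto
    also have "\<dots> \<longleftrightarrow> (\<forall>i\<in>{1..n-1}. \<forall>x. cmod (cinner (A i x) x) \<le> w n * ?q x)"
    proof (intro iffI ballI allI)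
      fix i x
      assume *: "\<forall>\<theta>\<in>{0..<2*pi}. \<forall>i\<in>{1..n-1}. \<forall>x.
          Re (exp (\<i> * complex_of_real \<theta>) * cinner (A i x) x) \<le> w n * ?q x" and "i \<in> {1..n-1}"
      obtain \<theta> where "\<theta> \<in> {0..<2*pi}"
        "exp (\<i> * complex_of_real \<theta>) * cinner (A i x) x = of_real (cmod (cinner (A i x) x))"
        by (rule obtain_rotation)
      then show "cmod (cinner (A i x) x) \<le> w n * ?q x"
        using * \<open>i \<in> {1..n-1}\<close> by (metis Re_complex_of_real)
    next
      fix \<theta> i x
      assume "\<forall>i\<in>{1..n-1}. \<forall>x. cmod (cinner (A i x) x) \<le> w n * ?q x" and "i \<in> {1..n-1}"
      then have "cmod (exp (\<i> * complex_of_real \<theta>) * cinner (A i x) x) \<le> w n * ?q x"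
        by (simp add: norm_mult)
      then show "Re (exp (\<i> * complex_of_real \<theta>) * cinner (A i x) x) \<le> w n * ?q x"
        by (rule order_trans[OF complex_Re_le_cmod])
    qed
    finally show ?thesis .
  qed
  \<comment> \<open>Self-adjointness moves the outer defect operator to the second argument. Both
    directions compare the two quadratic forms through this identity.\<close>
  have fund_cinner: "cinner (A i x) x = cinner (X (?D x)) (?D x)"
    if "contraction (S n)" "is_fundamental_op n S i X" for i X x
    using that by (simp add: A_def is_fundamental_op_def defect_op_selfadjoint)
  show ?thesis
  proof
    assume L: "?AY \<and> ?rad"
    then have contr: "contraction (S n)"
      by (simp add: AY_def)
    note D = bounded_clinear_defect_op[OF contr]
    show ?pos
      unfolding pos_iff
    proof (intro ballI allI)
      fix i x
      assume i: "i \<in> {1..n-1}"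
      then obtain X where X: "is_fundamental_op n S i X"
        using L unfolding AY_def by blast
      have "cmod (cinner (X (?D x)) (?D x))
          \<le> numerical_radius_on (defect_space (S n)) X * (norm (?D x))\<^sup>2"
        using X closure_subset[of "range ?D"]
        by (intro numerical_radius_on_bound)
          (auto simp: is_fundamental_op_def defect_space_def intro!: closure_range_scaleC[OF D])
      also have "\<dots> \<le> w n * (norm (?D x))\<^sup>2"
        using L i X by (intro mult_right_mono) auto
      finally show "cmod (cinner (A i x) x) \<le> w n * ?q x"
        by (simp add: fund_cinner[OF contr X] norm_defect_op[OF contr])
    qed
  next
    assume ?pos
    then have bound: "cmod (cinner (A i x) x) \<le> w n * ?q x" if "i \<in> {1..n-1}" for i x
      using pos_iff that by blast
    have contr: "contraction (S n)"
      unfolding contraction_def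
    proof (intro conjI allI Sn)
      fix x
      \<comment> \<open>Since \<open>n\<close> is at least 2, the index 1 is admissible. A modulus
        is nonnegative, hence so is \<open>?q x\<close>, which is the difference of the squared
        norms of \<open>x\<close> and \<open>S n x\<close>.\<close>
      have "0 \<le> w n * ?q x"
        using bound[of 1 x] assms(1) norm_ge_zero order_trans by (metis atLeastAtMost_iff
            diff_le_mono le_refl one_add_one add_diff_cancel_left')
      then have "0 \<le> ?q x"
        using assms(2) by (simp add: zero_le_mult_iff)
      then show "norm (S n x) \<le> norm x"
        by (simp add: cinner_diff_left cinner_cadjoint_left[OF Sn] cinner_self)
    qed
    note D = bounded_clinear_defect_op[OF contr]
    have bound': "cmod (cinner (A i x) x) \<le> w n * (norm (?D x))\<^sup>2" if "i \<in> {1..n-1}" for i x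
      using bound[OF that] by (simp add: norm_defect_op[OF contr])
    have "\<exists>X. is_fundamental_op n S i X" if i: "i \<in> {1..n-1}" for i
    proof -
      \<comment> \<open>The constant fed to the factorization is \<open>2 * w n\<close>. The factor
        2 from polarization affects only the norm bound on \<open>X\<close>, not the numerical
        radius estimate below.\<close>
      obtain X where X: "bounded_clinear X" "\<And>u. X u \<in> closure (range ?D)"
        "\<And>x. A i x = ?D (X (?D x))"
        using factorization[OF A[OF i] D defect_op_selfadjoint[OF contr] _
            form_bound[OF A[OF i] D _ bound'[OF i]]] assms(2) by auto
      have "is_fundamental_op n S i X"
        using X bounded_clinear_bound[OF X(1)]
        unfolding is_fundamental_op_def bounded_clinear_on_def defect_space_def
        by (metis A_def bounded_clinear_add bounded_clinear_scaleC)
      then show ?thesis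
        by (intro exI[of _ X])
    qed
    then have ?AY
      using assms(3) contr by (simp add: AY_def)
    moreover have ?rad
    proof (intro ballI allI impI)
      fix i X
      assume i: "i \<in> {1..n-1}" and X: "is_fundamental_op n S i X"
      \<comment> \<open>The sharp constant enters here: on vectors \<open>?D x\<close> the form of
        \<open>X\<close> is that of \<open>A i\<close>, which \<open>bound'\<close> controls with
        \<open>w n\<close> itself.\<close>
      show "numerical_radius_on (defect_space (S n)) X \<le> w n"
        unfolding defect_space_def
        using X assms(2) bound'[OF i] fund_cinner[OF contr X]
        by (intro numerical_radius_on_closure_range_le D)
          (auto simp: is_fundamental_op_def defect_space_def)
    qed
    ultimately show "?AY \<and> ?rad" ..
  qed
qed

end
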